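(* Consider the multi-agent sampled-data system with synchronous sampling times $t^k = k\Gamma$, $k\in\mathbb{Z}_{\ge 0}$, $\Gamma>0$, in which on each interval $[k\Gamma,(k+1)\Gamma)$ every agent $i\in\mathcal V$ evolves according to $\dot x_i(t)=f_i(x_i(t))+g_i(x_i(t))u_i(t^k)+\phi_i(t)$, and every adversarial agent $j\in\mathcal A$ applies $u_j(t^k)=u_j^{\max}(\vec x^k)$, where $\vec x^k=\vec x(t^k)$. Let $$K(\vec x^k)=\Big\{\vec u_{\mathcal N}^k\in\mathcal U_{\mathcal N}:\ \sum_{i\in\mathcal N}\big[L_{f_i}h^{x_i}(\vec x^k)+L_{g_i}h^{x_i}(\vec x^k)u_i^k\big]+\sum_{j\in\mathcal A}\gamma_j^{\max}(\vec x^k)+\alpha(h(\vec x^k))+\eta(\Gamma)\le 0\Big\}.$$ If $\vec x^k\in S$ for $k\ge 0$, then for any control input $\vec u_{\mathcal N}^k\in K(\vec x^k)$ of the normal agents the trajectory $\vec x(t)$ satisfies $\vec x(t)\in S$ for all $t\in[k\Gamma,(k+1)\Gamma)$.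
   Context: Agents: $\mathcal V=\{1,\dots,N\}$, partitioned into adversarial agents $\mathcal A\subset\mathcal V$ (known) and normal agents $\mathcal N=\mathcal V\setminus\mathcal A$. Agent $i$ has state $x_i\in\mathbb R^{n_i}$ and input $u_i\in\mathbb R^{m_i}$; $\bar n=\sum_i n_i$ and $\vec x=[x_1^T,\dots,x_N^T]^T\in\mathbb R^{\bar n}$. A function of $x_i$ is also written as a function of $\vec x$. The maps $f_i:\mathbb R^{n_i}\to\mathbb R^{n_i}$, $g_i:\mathbb R^{n_i}\to\mathbb R^{n_i\times m_i}$ are locally Lipschitz; the disturbances $\phi_i:\mathbb R\to\mathbb R^{n_i}$ are locally Lipschitz with $\|\phi_i(t)\|\le\phi_i^{\max}$ for all $t\ge0$. Inputs are held constant between sampling times (zero-order hold). Input constraints: $u_i\in\mathcal U_i(x_i)=\{u\in\mathbb R^{m_i}:A_i(x_i)u\le b_i(x_i)\}$, a nonempty compact convex polytope, with $A_i,b_i$ locally Lipschitz. For all $\vec x\in S$ the interior of $\mathcal U_i(\vec x)$, understood as $\{u:A_i(\vec x)u<b_i(\vec x)\}$, is nonempty and $\mathcal U_i$ is uniformly compact near $\vec x$ (there is a neighborhood of $\vec x$ such that the closure of the union of $\mathcal U_i(\vec y)$ over $\vec y$ in it is compact). $\mathcal U_{\mathcal N}$ is the Cartesian product of the $\mathcal U_i$, $i\in\mathcal N$ (evaluated at the sampled state), and $\vec u_{\mathcal N}$ is the vector of all normal agents' inputs. Safe set: $h:\mathbb R^{\bar n}\to\mathbb R$ is continuously differentiable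 with locally Lipschitz gradient; $S=\{\vec x:h(\vec x)\le0\}$ is compact, $\partial S=\{h=0\}$, $\mathrm{int}(S)=\{h<0\}$. $\alpha:\mathbb R\to\mathbb R$ is a locally Lipschitz extended class-$\mathcal K_\infty$ function (continuous, strictly increasing, $\alpha(0)=0$, $\alpha(s)\to\pm\infty$ as $s\to\pm\infty$). Partial Lie derivatives: $L_{f_i}h^{x_i}(\vec x)=\frac{\partial h(\vec x)}{\partial x_i}f_i(x_i)$, $L_{g_i}h^{x_i}(\vec x)=\frac{\partial h(\vec x)}{\partial x_i}g_i(x_i)$, $L_{\phi_i}h^{x_i}(\vec x)=\frac{\partial h(\vec x)}{\partial x_i}\phi_i(t)$. Adversaries: $u_j^{\max}(\vec x)\in\arg\max_{u\in\mathcal U_j(\vec x)}[L_{f_j}h^{x_j}(\vec x)+L_{g_j}h^{x_j}(\vec x)u]$, and $\gamma_j^{\max}(\vec x)=\max_{u\in\mathcal U_j(\vec x)}[L_{f_j}h^{x_j}(\vec x)+L_{g_j}h^{x_j}(\vec x)u]$. Constants: $c_f,c_g,c_\alpha,c_\gamma,c_h$ are constants such that for all $\vec x^1,\vec x^2\in S$: $\sum_{i\in\mathcal N}\|L_{f_i}h^{x_i}(\vec x^1)-L_{f_i}h^{x_i}(\vec x^2)\|\le c_f\|\vec x^1-\vec x^2\|$; $\sum_{i\in\mathcal N}\|L_{g_i}h^{x_i}(\vec x^1)-L_{g_i}h^{x_i}(\vec x^2)\|\le c_g\|\vec x^1-\vec x^2\|$; $\|\alpha(h(\vec x^1))-\alpha(h(\vec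 x^2))\|\le c_\alpha\|\vec x^1-\vec x^2\|$; $\sum_{j\in\mathcal A}\|\gamma_j^{\max}(\vec x^1)-\gamma_j^{\max}(\vec x^2)\|\le c_\gamma\|\vec x^1-\vec x^2\|$; $\|\sum_{l\in\mathcal V}L_{\phi_l}h^{x_l}(\vec x^1)\|\le c_h\sum_{l\in\mathcal V}\phi_l^{\max}$. The constant $u_{\max}\ge0$ satisfies $\|u_i^k\|\le u_{\max}$ for all $i\in\mathcal N$, $k\ge0$. The constant $\mu\ge0$ is an upper bound for the norm of the stacked vector with blocks $f_i(x_i)+g_i(x_i)u_i+\phi_i(t)$, $i=1,\dots,N$, over $\vec x\in S$, admissible inputs (all bounded by a common $u_M$) and $t\ge0$; $L'>0$ is any fixed constant. Define $\epsilon(\Gamma)=\frac{\mu}{L'}(e^{L'\Gamma}-1)$ and $$\eta(\Gamma)=(c_f+c_gu_{\max}+c_\alpha+c_\gamma)\,\epsilon(\Gamma)+c_h\sum_{l\in\mathcal V}\phi_l^{\max}.$$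
   Formalization: Two hypotheses are added, as the claim is false without either: S has nonempty interior, and each adversary's held input u_j^max(x^k) remains in U_j(x_j(t)) throughout the sampling interval (automatic if U_j does not depend on the state). *)

theory Defs
  imports "HOL-Analysis.Analysis"
begin

text \<open>
  The dimensions of the agents' state, input and constraint spaces depend on the agent, so they
  cannot be type indices.  Instead, the coordinates of the stacked vectors are indexed by finite
  types, and an owner map assigns an agent to each coordinate.  The space of agent \<open>i\<close> is the
  coordinate subspace \<open>block_space own i\<close>, whose dimension is the number of coordinates owned
  by \<open>i\<close>, and the component of a stacked vector belonging to agent \<open>i\<close> is its projection
  \<open>block own i\<close> to that subspace.
\<close>

definition block :: "('c \<Rightarrow> 'v) \<Rightarrow> 'v \<Rightarrow> real ^ 'c \<Rightarrow> real ^ 'c" where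
  "block own i x = (\<chi> c. if own c = i then x $ c else 0)"

definition block_space :: "('c \<Rightarrow> 'v) \<Rightarrow> 'v \<Rightarrow> (real ^ 'c) set" where
  "block_space own i = {x. \<forall>c. own c \<noteq> i \<longrightarrow> x $ c = 0}"

definition block_matrices :: "('r \<Rightarrow> 'v) \<Rightarrow> ('c \<Rightarrow> 'v) \<Rightarrow> 'v \<Rightarrow> (real ^ 'c ^ 'r) set" where
  "block_matrices rown cown i = {B. \<forall>r c. rown r \<noteq> i \<or> cown c \<noteq> i \<longrightarrow> B $ r $ c = 0}"

text \<open>The library notion is for time-dependent maps; here the time dependence is constant.\<close>

abbreviation loc_lipschitz_on ::
    "'a::metric_space set \<Rightarrow> ('a \<Rightarrow> 'b::metric_space) \<Rightarrow> bool" where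
  "loc_lipschitz_on X F \<equiv> local_lipschitz (UNIV :: real set) X (\<lambda>_. F)"

text \<open>
  Agents \<open>'v\<close>; coordinates of the stacked state \<open>'n\<close>, of the stacked input \<open>'m\<close>, and of
  the stacked right-hand sides of the input constraints \<open>'q\<close>.  In \<open>f_of M i\<close>, \<open>g_of M i\<close>,
  \<open>A_of M i\<close>, \<open>b_of M i\<close> the argument is the state of agent \<open>i\<close> alone, an element of
  \<open>block_space (state_of M) i\<close>.
\<close>

record ('v, 'n::finite, 'm::finite, 'q::finite) agents =
  state_of :: "'n \<Rightarrow> 'v"
  input_of :: "'m \<Rightarrow> 'v"
  row_of :: "'q \<Rightarrow> 'v"
  f_of :: "'v \<Rightarrow> real ^ 'n \<Rightarrow> real ^ 'n"
  g_of :: "'v \<Rightarrow> real ^ 'n \<Rightarrow> real ^ 'm ^ 'n"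
  phi_of :: "'v \<Rightarrow> real \<Rightarrow> real ^ 'n"
  A_of :: "'v \<Rightarrow> real ^ 'n \<Rightarrow> real ^ 'm ^ 'q"
  b_of :: "'v \<Rightarrow> real ^ 'n \<Rightarrow> real ^ 'q"

definition agent_state ::
    "('v, 'n::finite, 'm::finite, 'q::finite) agents \<Rightarrow> 'v \<Rightarrow> real ^ 'n \<Rightarrow> real ^ 'n" where
  "agent_state M i x = block (state_of M) i x"

definition input_set ::
    "('v, 'n::finite, 'm::finite, 'q::finite) agents \<Rightarrow> 'v \<Rightarrow> real ^ 'n \<Rightarrow> (real ^ 'm) set" where
  "input_set M i x = {u \<in> block_space (input_of M) i.
     \<forall>r. row_of M r = i \<longrightarrow>
       (A_of M i (agent_state M i x) *v u) $ r \<le> b_of M i (agent_state M i x) $ r}"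

definition strict_input_set ::
    "('v, 'n::finite, 'm::finite, 'q::finite) agents \<Rightarrow> 'v \<Rightarrow> real ^ 'n \<Rightarrow> (real ^ 'm) set" where
  "strict_input_set M i x = {u \<in> block_space (input_of M) i.
     \<forall>r. row_of M r = i \<longrightarrow>
       (A_of M i (agent_state M i x) *v u) $ r < b_of M i (agent_state M i x) $ r}"

definition uniformly_compact_near ::
    "('a::topological_space \<Rightarrow> 'b::topological_space set) \<Rightarrow> 'a \<Rightarrow> bool" where
  "uniformly_compact_near U x \<longleftrightarrow>
     (\<exists>W. open W \<and> x \<in> W \<and> compact (closure (\<Union>y\<in>W. U y)))"

definition regular_agents ::
    "('v, 'n::finite, 'm::finite, 'q::finite) agents \<Rightarrow> bool" where
  "regular_agents M \<longleftrightarrow> (\<forall>i.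
     f_of M i ` block_space (state_of M) i \<subseteq> block_space (state_of M) i \<and>
     g_of M i ` block_space (state_of M) i \<subseteq> block_matrices (state_of M) (input_of M) i \<and>
     A_of M i ` block_space (state_of M) i \<subseteq> block_matrices (row_of M) (input_of M) i \<and>
     b_of M i ` block_space (state_of M) i \<subseteq> block_space (row_of M) i \<and>
     range (phi_of M i) \<subseteq> block_space (state_of M) i \<and>
     loc_lipschitz_on (block_space (state_of M) i) (f_of M i) \<and>
     loc_lipschitz_on (block_space (state_of M) i) (g_of M i) \<and>
     loc_lipschitz_on (block_space (state_of M) i) (A_of M i) \<and>
     loc_lipschitz_on (block_space (state_of M) i) (b_of M i) \<and>
     loc_lipschitz_on UNIV (phi_of M i))"

definition agent_velocity ::
    "('v, 'n::finite, 'm::finite, 'q::finite) agents \<Rightarrow>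
     'v \<Rightarrow> real ^ 'n \<Rightarrow> real ^ 'm \<Rightarrow> real \<Rightarrow> real ^ 'n" where
  "agent_velocity M i x u t =
     f_of M i (agent_state M i x) + g_of M i (agent_state M i x) *v u + phi_of M i t"

definition gradient :: "(real ^ 'n \<Rightarrow> real) \<Rightarrow> real ^ 'n \<Rightarrow> real ^ 'n::finite" where
  "gradient h x = (\<chi> c. frechet_derivative h (at x) (axis c 1))"

definition lie_f ::
    "('v, 'n::finite, 'm::finite, 'q::finite) agents \<Rightarrow>
     (real ^ 'n \<Rightarrow> real) \<Rightarrow> 'v \<Rightarrow> real ^ 'n \<Rightarrow> real" where
  "lie_f M h i x = agent_state M i (gradient h x) \<bullet> f_of M i (agent_state M i x)"

definition lie_g ::
    "('v, 'n::finite, 'm::finite, 'q::finite) agents \<Rightarrow>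
     (real ^ 'n \<Rightarrow> real) \<Rightarrow> 'v \<Rightarrow> real ^ 'n \<Rightarrow> real ^ 'm" where
  "lie_g M h i x = agent_state M i (gradient h x) v* g_of M i (agent_state M i x)"

definition lie_phi ::
    "('v, 'n::finite, 'm::finite, 'q::finite) agents \<Rightarrow>
     (real ^ 'n \<Rightarrow> real) \<Rightarrow> 'v \<Rightarrow> real ^ 'n \<Rightarrow> real \<Rightarrow> real" where
  "lie_phi M h i x t = agent_state M i (gradient h x) \<bullet> phi_of M i t"

text \<open>The supremum is a maximum when the input set is nonempty and compact.\<close>

definition gamma_max ::
    "('v, 'n::finite, 'm::finite, 'q::finite) agents \<Rightarrow>
     (real ^ 'n \<Rightarrow> real) \<Rightarrow> 'v \<Rightarrow> real ^ 'n \<Rightarrow> real" where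
  "gamma_max M h j x = (SUP u\<in>input_set M j x. lie_f M h j x + lie_g M h j x \<bullet> u)"

definition extended_class_K_infinity :: "(real \<Rightarrow> real) \<Rightarrow> bool" where
  "extended_class_K_infinity \<alpha> \<longleftrightarrow>
     continuous_on UNIV \<alpha> \<and> strict_mono \<alpha> \<and> \<alpha> 0 = 0 \<and>
     filterlim \<alpha> at_top at_top \<and> filterlim \<alpha> at_bot at_bot"

definition epsilon :: "real \<Rightarrow> real \<Rightarrow> real \<Rightarrow> real" where
  "epsilon \<mu> L \<Gamma> = \<mu> / L * (exp (L * \<Gamma>) - 1)"

text \<open>
  Joint inputs are families indexed by the agents.  Only the inputs of the normal agents, those
  not in \<open>Adv\<close>, are constrained here; the values of \<open>u\<close> on \<open>Adv\<close> are irrelevant.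
\<close>

definition safe_inputs ::
    "('v::finite, 'n::finite, 'm::finite, 'q::finite) agents \<Rightarrow> 'v set \<Rightarrow> (real ^ 'n \<Rightarrow> real) \<Rightarrow>
     (real \<Rightarrow> real) \<Rightarrow> real \<Rightarrow> real ^ 'n \<Rightarrow> ('v \<Rightarrow> real ^ 'm) set" where
  "safe_inputs M Adv h \<alpha> \<eta> x = {u \<in> Pi (- Adv) (\<lambda>i. input_set M i x).
     (\<Sum>i\<in>- Adv. lie_f M h i x + lie_g M h i x \<bullet> u i) + (\<Sum>j\<in>Adv. gamma_max M h j x)
       + \<alpha> (h x) + \<eta> \<le> 0}"

end

theory Submission
  imports Defs
begin

text \<open>
  Along a trajectory, \<open>h\<close> changes at the rate \<open>gradient h x \<bullet> x'\<close>, which splits over the agents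
  into Lie derivatives because every agent moves within its own coordinates.  The safe
  input set only constrains this rate at the sampled state \<open>p\<close>, where the worst-case rate without
  disturbances, increased by \<open>\<alpha> (h p) + \<eta>\<close>, is non-positive; \<open>\<eta>\<close> has one summand for the drift
  since the last sampling time and one for the disturbances.  While the trajectory stays in \<open>S\<close>, its
  speed is at most \<open>\<mu>\<close>, so before the next sampling time its distance \<open>d\<close> from \<open>p\<close> satisfies
  \<open>d < \<mu> * \<Gamma> \<le> epsilon \<mu> L' \<Gamma>\<close> when \<open>\<mu> > 0\<close>.  The Lipschitz constants then turn the condition
  at \<open>p\<close> into one at the current state \<open>y\<close> (lemma \<open>barrier_rate_bound\<close>): with
  \<open>C = c_f + c_g * u_max + c_\<alpha> + c_\<gamma>\<close>, the rate at \<open>y\<close> is at most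
  \<open>- \<alpha> (h y) + C * (d - epsilon \<mu> L' \<Gamma>)\<close>.

  All of these estimates hold on \<open>S\<close> only, so nothing is known once the trajectory has left \<open>S\<close>,
  and a non-positive rate on the boundary would not suffice to conclude.  The rate there is
  strictly negative, however.  Indeed \<open>C > 0\<close>: the constants are non-negative because \<open>S\<close> has two
  distinct points, and \<open>c_\<alpha>\<close> is positive because \<open>h\<close> takes both negative values and the value \<open>0\<close>
  on \<open>S\<close>.  A trajectory at the boundary thus re-enters the interior, and the continuation principle
  \<open>closed_continuation\<close> shows that it never leaves.

  The strictness fails for \<open>\<mu> = 0\<close>.  In that case the sampled state is an equilibrium of the
  dynamics under the held inputs.  The right-hand side is Lipschitz at that state, uniformly in
  time (\<open>velocity_lipschitz_at\<close>), and uniqueness of solutions (\<open>equilibrium_is_kept\<close>) keeps the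
  trajectory there.
\<close>

section \<open>Agent-wise decomposition of stacked vectors\<close>

lemma sum_block: "(\<Sum>i\<in>UNIV. block own (i::'v::finite) y) = (y :: real ^ 'c::finite)"
  by (simp add: vec_eq_iff block_def)

lemma block_in_block_space: "block own i y \<in> block_space own i"
  by (simp add: block_def block_space_def)

lemma block_diff: "block own i (y - z) = block own i y - block own i z"
  by (simp add: vec_eq_iff block_def)

lemma norm_block_le: "norm (block own i (y :: real ^ 'c::finite)) \<le> norm y"
  by (rule norm_le_componentwise_cart) (simp add: block_def)

lemma inner_block:
  fixes y w :: "real ^ 'c::finite"
  assumes "w \<in> block_space own i"
  shows "block own i y \<bullet> w = y \<bullet> w"
  using assms by (auto simp: inner_vec_def block_def block_space_def intro!: sum.cong)

lemma block_matrix_vector_mult: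
  fixes B :: "real ^ 'c::finite ^ 'r::finite"
  assumes "B \<in> block_matrices rown cown i"
  shows "B *v u \<in> block_space rown i"
  using assms by (auto simp: block_matrices_def block_space_def matrix_vector_mult_def)

lemma has_derivative_gradient:
  fixes h :: "real ^ 'n::finite \<Rightarrow> real"
  assumes "h differentiable (at y)"
  shows "(h has_derivative (\<lambda>v. gradient h y \<bullet> v)) (at y)"
proof -
  interpret linear "frechet_derivative h (at y)"
    using assms by (rule linear_frechet_derivative)
  have "frechet_derivative h (at y) v = gradient h y \<bullet> v" for v
  proof -
    have "frechet_derivative h (at y) v
        = frechet_derivative h (at y) (\<Sum>c\<in>UNIV. v $ c *s axis c 1)"
      by (simp add: basis_expansion)
    also have "\<dots> = (\<Sum>c\<in>UNIV. v $ c * frechet_derivative h (at y) (axis c 1))"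
      by (simp add: sum scalar_mult_eq_scaleR scaleR)
    finally show ?thesis
      by (simp add: gradient_def inner_vec_def mult.commute)
  qed
  then have "frechet_derivative h (at y) = (\<lambda>v. gradient h y \<bullet> v)" ..
  then show ?thesis
    using assms by (simp add: frechet_derivative_works)
qed

text \<open>
  The velocity of agent \<open>i\<close> vanishes outside the coordinates of \<open>i\<close>, so its inner product with
  the gradient only sees the partial derivatives that enter the Lie derivatives of \<open>i\<close>.
\<close>

lemma gradient_inner_agent_velocity:
  fixes M :: "('v, 'n::finite, 'm::finite, 'q::finite) agents"
  assumes "regular_agents M"
  shows "gradient h y \<bullet> agent_velocity M i y w t
    = lie_f M h i y + lie_g M h i y \<bullet> w + lie_phi M h i y t"
proof -
  have y: "agent_state M i y \<in> block_space (state_of M) i"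
    by (simp add: agent_state_def block_in_block_space)
  then have "f_of M i (agent_state M i y) \<in> block_space (state_of M) i"
    "g_of M i (agent_state M i y) \<in> block_matrices (state_of M) (input_of M) i"
    "phi_of M i t \<in> block_space (state_of M) i"
    using assms unfolding regular_agents_def by blast+
  then show ?thesis
    by (simp add: agent_velocity_def lie_f_def lie_g_def lie_phi_def inner_add_right
        agent_state_def inner_block block_matrix_vector_mult dot_lmul_matrix)
qed

lemma gamma_max_upper:
  assumes "bounded (input_set M j y)" and "w \<in> input_set M j y"
  shows "lie_f M h j y + lie_g M h j y \<bullet> w \<le> gamma_max M h j y"
  unfolding gamma_max_def
proof (rule cSUP_upper)
  have "bounded ((\<lambda>v. lie_g M h j y \<bullet> v) ` input_set M j y)"
    by (intro bounded_linear_image assms(1) bounded_linear_inner_right)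
  then have "bounded ((\<lambda>v. lie_f M h j y + v) ` (\<lambda>v. lie_g M h j y \<bullet> v) ` input_set M j y)"
    by (rule bounded_translation)
  then show "bdd_above ((\<lambda>v. lie_f M h j y + lie_g M h j y \<bullet> v) ` input_set M j y)"
    by (simp add: image_image bounded_imp_bdd_above)
qed (fact assms(2))

section \<open>Rate of change of the barrier function\<close>

text \<open>
  The worst-case rate at \<open>y\<close> differs from the one at the sampled state \<open>p\<close> by Lipschitz terms:
  the normal agents' drift (\<open>c_f\<close>) and control terms (\<open>c_g\<close>, scaled by the input bound), and the
  adversaries' maximal contribution (\<open>c_\<gamma>\<close>).  The \<open>c_\<alpha>\<close> term replaces \<open>\<alpha> (h p)\<close> by
  \<open>\<alpha> (h y)\<close>, and the disturbance is absorbed by its bound \<open>D\<close>.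
\<close>

lemma barrier_rate_bound:
  fixes M :: "('v::finite, 'n::finite, 'm::finite, 'q::finite) agents"
  assumes reg: "regular_agents M"
    and safe: "w \<in> safe_inputs M Adv h \<alpha> \<eta> p"
    and f: "(\<Sum>i\<in>- Adv. \<bar>lie_f M h i y - lie_f M h i p\<bar>) \<le> c_f * d"
    and g: "(\<Sum>i\<in>- Adv. norm (lie_g M h i y - lie_g M h i p)) \<le> c_g * d"
    and a: "\<bar>\<alpha> (h y) - \<alpha> (h p)\<bar> \<le> c_\<alpha> * d"
    and c: "(\<Sum>j\<in>Adv. \<bar>gamma_max M h j y - gamma_max M h j p\<bar>) \<le> c_\<gamma> * d"
    and phi: "\<bar>\<Sum>l\<in>UNIV. lie_phi M h l y t\<bar> \<le> D"
    and u_max: "u_max \<ge> 0" "\<And>i. i \<notin> Adv \<Longrightarrow> norm (w i) \<le> u_max"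
    and adv: "\<And>j. j \<in> Adv \<Longrightarrow> bounded (input_set M j y) \<and> w j \<in> input_set M j y"
  shows "gradient h y \<bullet> (\<Sum>i\<in>UNIV. agent_velocity M i y (w i) t)
    \<le> - \<alpha> (h y) + (c_f + c_g * u_max + c_\<alpha> + c_\<gamma>) * d - \<eta> + D"
proof -
  define R where "R z i = lie_f M h i z + lie_g M h i z \<bullet> w i" for z i
  have "gradient h y \<bullet> (\<Sum>i\<in>UNIV. agent_velocity M i y (w i) t)
      = (\<Sum>i\<in>UNIV. R y i) + (\<Sum>l\<in>UNIV. lie_phi M h l y t)"
    by (simp add: inner_sum_right gradient_inner_agent_velocity[OF reg] R_def sum.distrib)
  also have "(\<Sum>i\<in>UNIV. R y i) = (\<Sum>i\<in>- Adv. R y i) + (\<Sum>j\<in>Adv. R y j)"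
    using sum.subset_diff[of Adv UNIV "R y"] by (simp add: Compl_eq_Diff_UNIV)
  finally have rate: "gradient h y \<bullet> (\<Sum>i\<in>UNIV. agent_velocity M i y (w i) t)
      = (\<Sum>i\<in>- Adv. R y i) + (\<Sum>j\<in>Adv. R y j) + (\<Sum>l\<in>UNIV. lie_phi M h l y t)" .
  have "R y i - R p i
      \<le> \<bar>lie_f M h i y - lie_f M h i p\<bar> + norm (lie_g M h i y - lie_g M h i p) * u_max"
    if "i \<in> - Adv" for i
  proof -
    have "(lie_g M h i y - lie_g M h i p) \<bullet> w i
        \<le> norm (lie_g M h i y - lie_g M h i p) * norm (w i)"
      by (rule norm_cauchy_schwarz)
    also have "\<dots> \<le> norm (lie_g M h i y - lie_g M h i p) * u_max"
      using u_max that by (intro mult_left_mono) auto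
    finally show ?thesis
      unfolding R_def by (simp add: inner_diff_left)
  qed
  then have "(\<Sum>i\<in>- Adv. R y i - R p i) \<le> (\<Sum>i\<in>- Adv.
      \<bar>lie_f M h i y - lie_f M h i p\<bar> + norm (lie_g M h i y - lie_g M h i p) * u_max)"
    by (rule sum_mono)
  also have "\<dots> \<le> c_f * d + c_g * d * u_max"
    unfolding sum.distrib sum_distrib_right[symmetric]
    by (intro add_mono f mult_right_mono g u_max(1))
  finally have normal: "(\<Sum>i\<in>- Adv. R y i) \<le> (\<Sum>i\<in>- Adv. R p i) + c_f * d + c_g * d * u_max"
    by (simp add: sum_subtractf)
  have "(\<Sum>j\<in>Adv. R y j) \<le> (\<Sum>j\<in>Adv. gamma_max M h j y)"
    unfolding R_def using adv by (intro sum_mono gamma_max_upper) auto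
  also have "\<dots> \<le> (\<Sum>j\<in>Adv. gamma_max M h j p + \<bar>gamma_max M h j y - gamma_max M h j p\<bar>)"
    by (intro sum_mono) linarith
  also have "\<dots> \<le> (\<Sum>j\<in>Adv. gamma_max M h j p) + c_\<gamma> * d"
    unfolding sum.distrib using c by simp
  finally have adversarial: "(\<Sum>j\<in>Adv. R y j) \<le> (\<Sum>j\<in>Adv. gamma_max M h j p) + c_\<gamma> * d" .
  have "(\<Sum>i\<in>- Adv. R p i) + (\<Sum>j\<in>Adv. gamma_max M h j p) + \<alpha> (h p) + \<eta> \<le> 0"
    using safe by (simp add: safe_inputs_def R_def)
  then show ?thesis
    using rate normal adversarial a phi by (simp add: algebra_simps)
qed

section \<open>Trajectories confined to closed sets\<close>

text \<open>
  The times before the first exit form an interval that is closed, because \<open>C\<close> is closed and \<open>x\<close> continuous,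
  and that can be extended beyond its last point.  The extension may use that the trajectory has
  been in \<open>C\<close> from the start, which is how estimates valid only on \<open>C\<close> enter.
\<close>

lemma closed_continuation:
  fixes x :: "real \<Rightarrow> 'a::topological_space"
  assumes cont: "continuous_on {a..<b} x" and "closed C" and start: "x a \<in> C"
    and step: "\<And>t. a \<le> t \<Longrightarrow> t < b \<Longrightarrow> (\<And>s. s \<in> {a..t} \<Longrightarrow> x s \<in> C) \<Longrightarrow>
      \<exists>d>0. \<forall>s\<in>{t<..<t + d}. s < b \<longrightarrow> x s \<in> C"
  shows "\<forall>t\<in>{a..<b}. x t \<in> C"
proof (rule ccontr)
  assume "\<not> ?thesis"
  then obtain t where t: "a \<le> t" "t < b" "x t \<notin> C"
    by auto
  define E where "E = {s \<in> {a..t}. x s \<notin> C}"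
  define T where "T = Inf E"
  have tE: "t \<in> E" and bdd: "bdd_below E"
    using t by (auto simp: E_def intro: bdd_belowI[of _ a])
  have T: "a \<le> T" "T \<le> t"
    unfolding T_def using tE bdd
    by (auto simp: E_def intro: cInf_greatest cInf_lower)
  have before: "x s \<in> C" if "s \<in> {a..<T}" for s
  proof (rule ccontr)
    assume "x s \<notin> C"
    then have "s \<in> E"
      using that T by (auto simp: E_def)
    then have "T \<le> s"
      unfolding T_def using bdd by (rule cInf_lower)
    with that show False by simp
  qed
  have upto: "x s \<in> C" if "s \<in> {a..T}" for s
  proof (cases "a = T")
    case True
    then show ?thesis using that start by simp
  next
    case False
    then have cl: "closure {a..<T} = {a..T}"
      using T by simp
    have "x ` closure {a..<T} \<subseteq> C"
    proof (rule image_closure_subset)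
      show "continuous_on (closure {a..<T}) x"
        unfolding cl using T t by (intro continuous_on_subset[OF cont]) auto
    qed (use before \<open>closed C\<close> in auto)
    then show ?thesis using that cl by auto
  qed
  obtain d where d: "d > 0" "\<forall>s\<in>{T<..<T + d}. s < b \<longrightarrow> x s \<in> C"
    using step[of T] upto T t by force
  have "T + d \<le> s" if "s \<in> E" for s
  proof (rule ccontr)
    assume "\<not> T + d \<le> s"
    moreover have "s < b" "a \<le> s" "x s \<notin> C"
      using that t by (auto simp: E_def)
    ultimately show False
      using d upto[of s] by (cases "s \<le> T") auto
  qed
  then have "T + d \<le> T"
    unfolding T_def using tE by (intro cInf_greatest) auto
  with d show False by simp
qed

lemma speed_bound:
  fixes x v :: "real \<Rightarrow> 'a::real_normed_vector"
  assumes deriv: "\<And>s. s \<in> {a..t} \<Longrightarrow> (x has_vector_derivative v s) (at s within {a..t})"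
    and bound: "\<And>s. s \<in> {a..t} \<Longrightarrow> norm (v s) \<le> B"
    and "a \<le> t"
  shows "norm (x t - x a) \<le> B * (t - a)"
proof -
  have "norm (x t - x a) \<le> B * norm (t - a)"
  proof (rule differentiable_bound[where S = "{a..t}" and f' = "\<lambda>s r. r *\<^sub>R v s"])
    show "onorm (\<lambda>r. r *\<^sub>R v s) \<le> B" if "s \<in> {a..t}" for s
      using bound[OF that] by (intro onorm_le) (simp add: mult.commute[of B] mult_left_mono)
  qed (use deriv \<open>a \<le> t\<close> in \<open>auto simp: has_vector_derivative_def\<close>)
  then show ?thesis using \<open>a \<le> t\<close> by simp
qed

text \<open>
  Over a time step so short that \<open>\<bar>K\<bar>\<close> times its length is at most \<open>1/2\<close>, the greatest distance
  from \<open>p\<close> is at most half of itself, hence zero.  The speed only has to be controlled along the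
  trajectory and by the distance from \<open>p\<close>, which suffices for uniqueness of the constant solution.
\<close>

lemma equilibrium_is_kept:
  fixes x v :: "real \<Rightarrow> 'a::real_normed_vector"
  assumes deriv: "\<And>t. t \<in> {a..<b} \<Longrightarrow> (x has_vector_derivative v t) (at t within {a..<b})"
    and lip: "\<forall>\<^sub>F y in nhds p. \<forall>t\<in>{a..<b}. x t = y \<longrightarrow> norm (v t) \<le> K * norm (y - p)"
    and start: "x a = p"
  shows "\<forall>t\<in>{a..<b}. x t = p"
proof -
  have cont: "continuous_on {a..<b} x"
    using deriv by (intro continuous_on_vector_derivative)
  obtain r where r: "r > 0"
    "\<And>t. t \<in> {a..<b} \<Longrightarrow> dist (x t) p < r \<Longrightarrow> norm (v t) \<le> K * norm (x t - p)"
    using lip unfolding eventually_nhds_metric by blast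
  have "\<forall>t\<in>{a..<b}. x t \<in> {p}"
  proof (rule closed_continuation[OF cont])
    fix t assume t: "a \<le> t" "t < b" and "\<And>s. s \<in> {a..t} \<Longrightarrow> x s \<in> {p}"
    then have xt: "x t = p" by simp
    obtain \<delta> where \<delta>: "\<delta> > 0" "\<And>s. s \<in> {a..<b} \<Longrightarrow> dist s t < \<delta> \<Longrightarrow> dist (x s) p < r"
      using cont t r(1) xt unfolding continuous_on_iff by (metis atLeastLessThan_iff)
    define d where "d = min (min \<delta> (b - t)) (1 / (\<bar>K\<bar> + 1)) / 2"
    have "d > 0"
      using \<delta>(1) t by (simp add: d_def add_nonneg_pos)
    moreover have "d \<le> \<delta> / 2" "d \<le> (b - t) / 2" and d_le: "d \<le> 1 / (\<bar>K\<bar> + 1) / 2"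
      unfolding d_def by (intro divide_right_mono; simp)+
    ultimately have d: "d > 0" "d < \<delta>" "t + d < b"
      using \<delta>(1) t by (simp_all add: field_simps)
    from d_le have Kd: "\<bar>K\<bar> * d \<le> 1 / 2"
      using d(1) by (simp add: field_simps)
    have sub: "{t..t + d} \<subseteq> {a..<b}"
      using t d by auto
    have "continuous_on {t..t + d} (\<lambda>s. norm (x s - p))"
      by (intro continuous_intros continuous_on_subset[OF cont sub])
    moreover have "{t..t + d} \<noteq> {}"
      using d(1) by simp
    ultimately obtain m where m: "m \<in> {t..t + d}"
      "\<And>s. s \<in> {t..t + d} \<Longrightarrow> norm (x s - p) \<le> norm (x m - p)"
      using continuous_attains_sup[OF compact_Icc] by blast
    have "norm (x m - x t) \<le> (\<bar>K\<bar> * norm (x m - p)) * (m - t)"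
    proof (rule speed_bound)
      fix s assume s: "s \<in> {t..m}"
      then have s': "s \<in> {t..t + d}" "s \<in> {a..<b}"
        using m(1) t d by auto
      show "(x has_vector_derivative v s) (at s within {t..m})"
        using m(1) t d by (intro has_vector_derivative_within_subset[OF deriv[OF s'(2)]]) auto
      have "norm (v s) \<le> K * norm (x s - p)"
        using s' d by (intro r(2) \<delta>(2)) (auto simp: dist_real_def)
      also have "\<dots> \<le> \<bar>K\<bar> * norm (x s - p)"
        by (intro mult_right_mono) auto
      also have "\<dots> \<le> \<bar>K\<bar> * norm (x m - p)"
        by (intro mult_left_mono m(2) s'(1)) auto
      finally show "norm (v s) \<le> \<bar>K\<bar> * norm (x m - p)" .
    qed (use m(1) in auto)
    also have "\<dots> \<le> (\<bar>K\<bar> * norm (x m - p)) * d"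
      using m(1) by (intro mult_left_mono) auto
    also have "\<dots> = (\<bar>K\<bar> * d) * norm (x m - p)"
      by (simp add: mult_ac)
    also have "\<dots> \<le> 1 / 2 * norm (x m - p)"
      by (intro mult_right_mono Kd) auto
    finally have "norm (x m - p) \<le> 0"
      using xt by simp
    then have "x s = p" if "s \<in> {t..t + d}" for s
      using m(2)[OF that] by simp
    then show "\<exists>d>0. \<forall>s\<in>{t<..<t + d}. s < b \<longrightarrow> x s \<in> {p}"
      using d(1) by (intro exI[of _ d]) auto
  qed (use start in auto)
  then show ?thesis by simp
qed

section \<open>Lipschitz bounds for the stacked dynamics\<close>

text \<open>
  The dynamics of an agent are Lipschitz only on its own coordinate subspace.  The projection to
  that subspace does not increase distances, so the bound carries over to stacked states.
\<close>

lemma lipschitz_at_through_block: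
  fixes F :: "real ^ 'c::finite \<Rightarrow> 'b::real_normed_vector"
  assumes "loc_lipschitz_on (block_space own i) F"
  shows "\<exists>K. \<forall>\<^sub>F y in nhds p. norm (F (block own i y) - F (block own i p)) \<le> K * norm (y - p)"
proof -
  let ?X = "block_space own i" and ?s = "block own i"
  have le: "dist (?s y) (?s p) \<le> dist y p" for y
    by (simp add: dist_norm block_diff[symmetric] norm_block_le)
  obtain r K where r: "r > 0" and K: "K-lipschitz_on (cball (?s p) r \<inter> ?X) F"
    using local_lipschitzE[OF assms UNIV_I block_in_block_space, of 0]
    by (metis Int_UNIV_right centre_in_cball less_eq_real_def)
  have "norm (F (?s y) - F (?s p)) \<le> K * norm (y - p)" if "dist y p < r" for y
  proof -
    have "?s y \<in> cball (?s p) r \<inter> ?X" "?s p \<in> cball (?s p) r \<inter> ?X"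
      using le[of y] that r by (auto simp: dist_commute block_in_block_space)
    then have "dist (F (?s y)) (F (?s p)) \<le> K * dist (?s y) (?s p)"
      by (rule lipschitz_onD[OF K])
    also have "\<dots> \<le> K * dist y p"
      by (intro mult_left_mono le lipschitz_on_nonneg[OF K])
    finally show ?thesis
      by (simp add: dist_norm)
  qed
  then show ?thesis
    using r unfolding eventually_nhds_metric by blast
qed

lemma norm_matrix_vector_mult_le:
  fixes B :: "real ^ 'm::finite ^ 'n::finite"
  shows "norm (B *v w) \<le> norm B * norm w"
proof -
  have "norm (B *v w) \<le> L2_set (\<lambda>r. norm (B $ r) * norm w) UNIV"
    unfolding norm_vec_def[of "B *v w"]
    by (intro L2_set_mono) (simp_all add: matrix_mult_dot Cauchy_Schwarz_ineq2)
  then show ?thesis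
    by (simp add: norm_vec_def[of B] L2_set_left_distrib)
qed

text \<open>
  The constant \<open>K\<close> may depend on the inputs \<open>w\<close>, which are held.  The disturbance cancels
  because it does not depend on the state, which makes the bound uniform in time.
\<close>

lemma velocity_lipschitz_at:
  fixes M :: "('v::finite, 'n::finite, 'm::finite, 'q::finite) agents"
  assumes reg: "regular_agents M"
  shows "\<exists>K. \<forall>\<^sub>F y in nhds p. \<forall>t.
    norm ((\<Sum>i\<in>UNIV. agent_velocity M i y (w i) t) - (\<Sum>i\<in>UNIV. agent_velocity M i p (w i) t))
      \<le> K * norm (y - p)"
proof -
  have "\<exists>K. \<forall>\<^sub>F y in nhds p. \<forall>t.
      norm (agent_velocity M i y (w i) t - agent_velocity M i p (w i) t) \<le> K * norm (y - p)" for i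
  proof -
    let ?f = "\<lambda>y. f_of M i (agent_state M i y)" and ?g = "\<lambda>y. g_of M i (agent_state M i y)"
    have f: "loc_lipschitz_on (block_space (state_of M) i) (f_of M i)"
      and g: "loc_lipschitz_on (block_space (state_of M) i) (g_of M i)"
      using reg unfolding regular_agents_def by blast+
    obtain K1 where K1: "\<forall>\<^sub>F y in nhds p. norm (?f y - ?f p) \<le> K1 * norm (y - p)"
      using lipschitz_at_through_block[OF f, of p] unfolding agent_state_def ..
    obtain K2 where K2: "\<forall>\<^sub>F y in nhds p. norm (?g y - ?g p) \<le> K2 * norm (y - p)"
      using lipschitz_at_through_block[OF g, of p] unfolding agent_state_def ..
    have "\<forall>\<^sub>F y in nhds p. \<forall>t.
        norm (agent_velocity M i y (w i) t - agent_velocity M i p (w i) t)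
          \<le> (K1 + K2 * norm (w i)) * norm (y - p)"
      using K1 K2
    proof (rule eventually_elim2, intro allI)
      fix y t
      assume f_le: "norm (?f y - ?f p) \<le> K1 * norm (y - p)"
        and g_le: "norm (?g y - ?g p) \<le> K2 * norm (y - p)"
      have "agent_velocity M i y (w i) t - agent_velocity M i p (w i) t
          = (?f y - ?f p) + (?g y - ?g p) *v w i"
        by (simp add: agent_velocity_def matrix_vector_mult_diff_rdistrib)
      also have "norm \<dots> \<le> K1 * norm (y - p) + norm (?g y - ?g p) * norm (w i)"
        by (intro norm_triangle_mono f_le norm_matrix_vector_mult_le)
      also have "\<dots> \<le> K1 * norm (y - p) + K2 * norm (y - p) * norm (w i)"
        by (intro add_left_mono mult_right_mono g_le) auto
      finally show "norm (agent_velocity M i y (w i) t - agent_velocity M i p (w i) t)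
          \<le> (K1 + K2 * norm (w i)) * norm (y - p)"
        by (simp add: algebra_simps)
    qed
    then show ?thesis by blast
  qed
  then have "\<forall>i. \<exists>K. \<forall>\<^sub>F y in nhds p. \<forall>t.
      norm (agent_velocity M i y (w i) t - agent_velocity M i p (w i) t) \<le> K * norm (y - p)"
    by (rule allI)
  from choice[OF this] obtain K where "\<forall>i. \<forall>\<^sub>F y in nhds p. \<forall>t.
      norm (agent_velocity M i y (w i) t - agent_velocity M i p (w i) t) \<le> K i * norm (y - p)" ..
  then have "\<forall>\<^sub>F y in nhds p. \<forall>i. \<forall>t.
      norm (agent_velocity M i y (w i) t - agent_velocity M i p (w i) t) \<le> K i * norm (y - p)"
    by (intro eventually_all_finite) (erule spec)
  then have "\<forall>\<^sub>F y in nhds p. \<forall>t.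
      norm ((\<Sum>i\<in>UNIV. agent_velocity M i y (w i) t) - (\<Sum>i\<in>UNIV. agent_velocity M i p (w i) t))
        \<le> (\<Sum>i\<in>UNIV. K i) * norm (y - p)"
    unfolding sum_subtractf[symmetric] sum_distrib_right
    by (rule eventually_mono) (intro allI sum_norm_le, blast)
  then show ?thesis ..
qed

section \<open>Safety between sampling times\<close>

theorem theorem1:
  fixes M :: "('v::finite, 'n::finite, 'm::finite, 'q::finite) agents"
    and Adv :: "'v set"
    and h :: "real ^ 'n \<Rightarrow> real" and S :: "(real ^ 'n) set" and \<alpha> :: "real \<Rightarrow> real"
    and phi_max :: "'v \<Rightarrow> real" and u_worst :: "'v \<Rightarrow> real ^ 'n \<Rightarrow> real ^ 'm"
    and c_f c_g c_\<alpha> c_\<gamma> c_h u_max u_M \<mu> L' \<Gamma> \<eta> :: real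
    and k :: nat and u :: "nat \<Rightarrow> 'v \<Rightarrow> real ^ 'm" and x :: "real \<Rightarrow> real ^ 'n"
  assumes "regular_agents M"
    and "\<And>i t. t \<ge> 0 \<Longrightarrow> norm (phi_of M i t) \<le> phi_max i"
    and "\<And>i y. polytope (input_set M i y) \<and> input_set M i y \<noteq> {}"
    and "\<And>i y. y \<in> S \<Longrightarrow> strict_input_set M i y \<noteq> {} \<and> uniformly_compact_near (input_set M i) y"
    and "\<And>y. h differentiable (at y)"
    and "continuous_on UNIV (gradient h)" and "loc_lipschitz_on UNIV (gradient h)"
    and "S = {y. h y \<le> 0}" and "compact S"
    and "frontier S = {y. h y = 0}" and "interior S = {y. h y < 0}"
    and "interior S \<noteq> {}"
    and "extended_class_K_infinity \<alpha>" and "loc_lipschitz_on UNIV \<alpha>"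
    and "\<And>j y. j \<in> Adv \<Longrightarrow>
      is_arg_max (\<lambda>v. lie_f M h j y + lie_g M h j y \<bullet> v) (\<lambda>v. v \<in> input_set M j y) (u_worst j y)"
    and "\<And>y z. y \<in> S \<Longrightarrow> z \<in> S \<Longrightarrow>
      (\<Sum>i\<in>- Adv. \<bar>lie_f M h i y - lie_f M h i z\<bar>) \<le> c_f * norm (y - z)"
    and "\<And>y z. y \<in> S \<Longrightarrow> z \<in> S \<Longrightarrow>
      (\<Sum>i\<in>- Adv. norm (lie_g M h i y - lie_g M h i z)) \<le> c_g * norm (y - z)"
    and "\<And>y z. y \<in> S \<Longrightarrow> z \<in> S \<Longrightarrow> \<bar>\<alpha> (h y) - \<alpha> (h z)\<bar> \<le> c_\<alpha> * norm (y - z)"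
    and "\<And>y z. y \<in> S \<Longrightarrow> z \<in> S \<Longrightarrow>
      (\<Sum>j\<in>Adv. \<bar>gamma_max M h j y - gamma_max M h j z\<bar>) \<le> c_\<gamma> * norm (y - z)"
    and "\<And>y t. y \<in> S \<Longrightarrow> t \<ge> 0 \<Longrightarrow>
      \<bar>\<Sum>l\<in>UNIV. lie_phi M h l y t\<bar> \<le> c_h * (\<Sum>l\<in>UNIV. phi_max l)"
    and "u_max \<ge> 0" and "\<And>i k'. i \<notin> Adv \<Longrightarrow> norm (u k' i) \<le> u_max"
    and "\<And>i y v. y \<in> S \<Longrightarrow> v \<in> input_set M i y \<Longrightarrow> norm v \<le> u_M"
    and "\<mu> \<ge> 0"
    and "\<And>y z v t. y \<in> S \<Longrightarrow> z \<in> S \<Longrightarrow> (\<And>i. v i \<in> input_set M i z) \<Longrightarrow> t \<ge> 0 \<Longrightarrow>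
      norm (\<Sum>i\<in>UNIV. agent_velocity M i y (v i) t) \<le> \<mu>"
    and "L' > 0" and "\<Gamma> > 0"
    and "\<eta> = (c_f + c_g * u_max + c_\<alpha> + c_\<gamma>) * epsilon \<mu> L' \<Gamma> + c_h * (\<Sum>l\<in>UNIV. phi_max l)"
    and "\<And>i t. t \<in> {real k * \<Gamma>..<real (k + 1) * \<Gamma>} \<Longrightarrow>
      ((\<lambda>s. agent_state M i (x s)) has_vector_derivative agent_velocity M i (x t) (u k i) t)
        (at t within {real k * \<Gamma>..<real (k + 1) * \<Gamma>})"
    and "\<And>j. j \<in> Adv \<Longrightarrow> u k j = u_worst j (x (real k * \<Gamma>))"
    and "\<And>j t. j \<in> Adv \<Longrightarrow> t \<in> {real k * \<Gamma>..<real (k + 1) * \<Gamma>} \<Longrightarrow> u k j \<in> input_set M j (x t)"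
    and "x (real k * \<Gamma>) \<in> S"
    and "u k \<in> safe_inputs M Adv h \<alpha> \<eta> (x (real k * \<Gamma>))"
  shows "\<forall>t\<in>{real k * \<Gamma>..<real (k + 1) * \<Gamma>}. x t \<in> S"
proof -
  note reg = assms(1) and poly = assms(3) and h_diff = assms(5) and S_def = assms(8)
    and c_f = assms(16) and c_g = assms(17) and c_\<alpha> = assms(18) and c_\<gamma> = assms(19)
    and c_h = assms(20) and mu = assms(24) and speed = assms(25)
    and deriv = assms(29) and adv = assms(31) and start = assms(32) and safe = assms(33)
  define a b p where "a = real k * \<Gamma>" and "b = real (k + 1) * \<Gamma>" and "p = x a"
  have ab: "0 \<le> a" "a < b" "b - a = \<Gamma>"
    using \<open>\<Gamma> > 0\<close> by (auto simp: a_def b_def algebra_simps)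
  have pS: "p \<in> S"
    using start by (simp add: p_def a_def)
  have closed: "closed S"
    using \<open>compact S\<close> by (rule compact_imp_closed)
  define V where "V t = (\<Sum>i\<in>UNIV. agent_velocity M i (x t) (u k i) t)" for t
  have x_deriv: "(x has_vector_derivative V t) (at t within {a..<b})" if "t \<in> {a..<b}" for t
  proof -
    have "((\<lambda>s. \<Sum>i\<in>UNIV. agent_state M i (x s)) has_vector_derivative V t) (at t within {a..<b})"
      unfolding V_def using deriv that by (intro has_vector_derivative_sum) (simp add: a_def b_def)
    then show ?thesis
      by (simp add: agent_state_def sum_block)
  qed
  then have cont: "continuous_on {a..<b} x"
    by (intro continuous_on_vector_derivative)
  have admissible: "u k i \<in> input_set M i p" for i
  proof (cases "i \<in> Adv")
    case True
    then show ?thesis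
      using assms(15)[OF True, of p] assms(30)[OF True] by (simp add: is_arg_max_def p_def a_def)
  next
    case False
    then show ?thesis
      using safe by (auto simp: safe_inputs_def p_def a_def)
  qed
  have speed': "norm (\<Sum>i\<in>UNIV. agent_velocity M i y (u k i) t) \<le> \<mu>" if "y \<in> S" "t \<ge> a" for y t
    using speed[OF that(1) pS admissible] that(2) ab(1) by simp
  have "\<forall>t\<in>{a..<b}. x t \<in> S"
  proof (cases "\<mu> = 0")
    case True
    \<comment> \<open>The held inputs give zero velocity within \<open>S\<close>, but maybe not outside.\<close>
    obtain K where K: "\<forall>\<^sub>F y in nhds p. \<forall>t.
        norm ((\<Sum>i\<in>UNIV. agent_velocity M i y (u k i) t) - (\<Sum>i\<in>UNIV. agent_velocity M i p (u k i) t))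
          \<le> K * norm (y - p)"
      using velocity_lipschitz_at[OF reg] by blast
    have "\<forall>t\<in>{a..<b}. x t = p"
    proof (rule equilibrium_is_kept[OF x_deriv])
      show "\<forall>\<^sub>F y in nhds p. \<forall>t\<in>{a..<b}. x t = y \<longrightarrow> norm (V t) \<le> K * norm (y - p)"
        using K
      proof (rule eventually_mono, intro ballI impI)
        fix y t
        assume *: "\<forall>t. norm ((\<Sum>i\<in>UNIV. agent_velocity M i y (u k i) t)
          - (\<Sum>i\<in>UNIV. agent_velocity M i p (u k i) t)) \<le> K * norm (y - p)"
          and t: "t \<in> {a..<b}" "x t = y"
        have "(\<Sum>i\<in>UNIV. agent_velocity M i p (u k i) t) = 0"
          using speed'[OF pS, of t] t True by simp
        then show "norm (V t) \<le> K * norm (y - p)"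
          using *[rule_format, of t] t by (simp add: V_def)
      qed
    qed (simp_all add: p_def)
    then show ?thesis using pS by simp
  next
    case False
    define e C where "e = epsilon \<mu> L' \<Gamma>" and "C = c_f + c_g * u_max + c_\<alpha> + c_\<gamma>"
    \<comment> \<open>The exponential bound dominates the linear one given by the maximal speed.\<close>
    have "L' * \<Gamma> \<le> exp (L' * \<Gamma>) - 1"
      using exp_ge_add_one_self[of "L' * \<Gamma>"] by linarith
    then have "\<mu> / L' * (L' * \<Gamma>) \<le> e"
      unfolding e_def epsilon_def using mu \<open>L' > 0\<close> by (intro mult_left_mono) auto
    then have e: "\<mu> * \<Gamma> \<le> e"
      using \<open>L' > 0\<close> by simp
    have C: "C > 0"
    proof -
      \<comment> \<open>An interior and a boundary point of \<open>S\<close> are distinct, and \<open>\<alpha>\<close> separates their values of \<open>h\<close>.\<close>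
      obtain y where y: "h y < 0"
        using assms(11,12) by auto
      have "S \<noteq> UNIV"
        using \<open>compact S\<close> compact_imp_bounded not_bounded_UNIV by metis
      then have "frontier S \<noteq> {}"
        using pS by (auto simp: frontier_eq_empty)
      then obtain z where z: "h z = 0"
        using assms(10) by auto
      have yz: "y \<in> S" "z \<in> S" "norm (y - z) > 0"
        using y z by (auto simp: S_def)
      have "\<alpha> (h y) < \<alpha> (h z)"
        using assms(13) y z unfolding extended_class_K_infinity_def
        by (intro strict_monoD[of \<alpha>]) auto
      then have "0 < c_\<alpha> * norm (y - z)"
        using c_\<alpha>[OF yz(1,2)] by linarith
      moreover have "0 \<le> c_f * norm (y - z)" "0 \<le> c_g * norm (y - z)" "0 \<le> c_\<gamma> * norm (y - z)"
        using c_f[OF yz(1,2)] c_g[OF yz(1,2)] c_\<gamma>[OF yz(1,2)]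
        by (meson abs_ge_zero norm_ge_zero order_trans sum_nonneg)+
      ultimately have "c_\<alpha> > 0" "c_f \<ge> 0" "c_g \<ge> 0" "c_\<gamma> \<ge> 0"
        using yz(3) by (simp_all add: zero_less_mult_iff zero_le_mult_iff)
      then show ?thesis
        unfolding C_def using \<open>u_max \<ge> 0\<close> by (simp add: add_nonneg_pos add_pos_nonneg)
    qed
    show ?thesis
    proof (rule closed_continuation[OF cont closed])
      show "x a \<in> S" using pS by (simp add: p_def)
    next
      fix t assume t: "a \<le> t" "t < b" and stay: "\<And>s. s \<in> {a..t} \<Longrightarrow> x s \<in> S"
      have tab: "t \<in> {a..<b}" and yS: "x t \<in> S"
        using t stay by auto
      have "norm (x t - x a) \<le> \<mu> * (t - a)"
      proof (rule speed_bound)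
        show "(x has_vector_derivative V s) (at s within {a..t})" if "s \<in> {a..t}" for s
          using that t by (intro has_vector_derivative_within_subset[OF x_deriv]) auto
        show "norm (V s) \<le> \<mu>" if "s \<in> {a..t}" for s
          unfolding V_def using that by (intro speed' stay) auto
      qed (use t in auto)
      \<comment> \<open>Strict, because \<open>t\<close> lies before the next sampling time.\<close>
      also have "\<dots> < \<mu> * \<Gamma>"
        using t ab(3) mu False by (intro mult_strict_left_mono) auto
      finally have dist: "norm (x t - p) < e"
        using e by (simp add: p_def)
      have "gradient h (x t) \<bullet> V t
          \<le> - \<alpha> (h (x t)) + C * norm (x t - p) - \<eta> + c_h * (\<Sum>l\<in>UNIV. phi_max l)"
        unfolding V_def C_def
      proof (rule barrier_rate_bound[OF reg])
        show "u k \<in> safe_inputs M Adv h \<alpha> \<eta> p"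
          using safe by (simp add: p_def a_def)
        show "\<bar>\<Sum>l\<in>UNIV. lie_phi M h l (x t) t\<bar> \<le> c_h * (\<Sum>l\<in>UNIV. phi_max l)"
          using yS t ab by (intro c_h) auto
        show "bounded (input_set M j (x t)) \<and> u k j \<in> input_set M j (x t)" if "j \<in> Adv" for j
          using poly adv[OF that, of t] tab by (simp add: polytope_imp_bounded a_def b_def)
      qed (use c_f c_g c_\<alpha> c_\<gamma> yS pS assms(21,22) in auto)
      also have "\<dots> = - \<alpha> (h (x t)) + C * (norm (x t - p) - e)"
        by (simp add: assms(28) C_def e_def algebra_simps)
      also have "\<dots> < - \<alpha> (h (x t))"
        using C dist by (simp add: mult_pos_neg)
      finally have rate: "gradient h (x t) \<bullet> V t < - \<alpha> (h (x t))" .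
      have hx_deriv: "((\<lambda>s. h (x s)) has_real_derivative gradient h (x t) \<bullet> V t)
          (at t within {a..<b})"
      proof -
        from has_derivative_compose[OF x_deriv[OF tab, unfolded has_vector_derivative_def]
            has_derivative_gradient[OF h_diff]]
        show ?thesis
          by (simp add: has_field_derivative_def mult.commute[of _ "gradient h (x t) \<bullet> V t"])
      qed
      show "\<exists>d>0. \<forall>s\<in>{t<..<t + d}. s < b \<longrightarrow> x s \<in> S"
      proof (cases "h (x t) = 0")
        case True
        then have "gradient h (x t) \<bullet> V t < 0"
          using rate assms(13) by (simp add: extended_class_K_infinity_def)
        from has_real_derivative_neg_dec_right[OF hx_deriv this] obtain d where
          d: "d > 0" "\<And>r. r > 0 \<Longrightarrow> t + r \<in> {a..<b} \<Longrightarrow> r < d \<Longrightarrow> h (x (t + r)) < h (x t)"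
          by blast
        have "x s \<in> S" if "s \<in> {t<..<t + d}" "s < b" for s
          using d(2)[of "s - t"] that t True by (simp add: S_def)
        then show ?thesis using d(1) by blast
      next
        case False
        then have "h (x t) < 0"
          using yS by (simp add: S_def)
        moreover have "continuous (at t within {a..<b}) (\<lambda>s. h (x s))"
          using hx_deriv by (rule DERIV_continuous)
        ultimately have "\<forall>\<^sub>F s in at t within {a..<b}. h (x s) < 0"
          unfolding continuous_within by (intro order_tendstoD)
        then obtain d where
          d: "d > 0" "\<And>s. s \<in> {a..<b} \<Longrightarrow> s \<noteq> t \<Longrightarrow> dist s t < d \<Longrightarrow> h (x s) < 0"
          unfolding eventually_at by blast
        have "x s \<in> S" if "s \<in> {t<..<t + d}" "s < b" for s
          using d(2)[of s] that t by (simp add: S_def dist_real_def)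
        then show ?thesis using d(1) by blast
      qed
    qed
  qed
  then show ?thesis
    by (simp add: a_def b_def)
qed

end
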